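(* Let $(X,(\cdot,\cdot|\cdot))$ be a 2-inner product space over $\mathbb{K}\in\{\mathbb{R},\mathbb{C}\}$, let $n$ be a positive integer, let $z_1,\dots,z_n,z\in X$ and $\mu_1,\dots,\mu_n\in\mathbb{K}$. Define $A_1=\max_{1\le i\le n}|\mu_i|^2\sum_{i=1}^n\|z_i|z\|^2$; $A_2(\alpha)=\big(\sum_{i=1}^n|\mu_i|^{2\alpha}\big)^{1/\alpha}\big(\sum_{i=1}^n\|z_i|z\|^{2\beta}\big)^{1/\beta}$ for $\alpha>1$, $\frac1\alpha+\frac1\beta=1$; $A_3=\sum_{i=1}^n|\mu_i|^2\max_{1\le i\le n}\|z_i|z\|^2$; and $B_1=\max_{1\le i\ne j\le n}|\mu_i\mu_j|\sum_{1\le i\ne j\le n}|(z_i,z_j|z)|$; $B_2(\gamma)=\Big[\big(\sum_{i=1}^n|\mu_i|^{\gamma}\big)^2-\sum_{i=1}^n|\mu_i|^{2\gamma}\Big]^{1/\gamma}\big(\sum_{1\le i\ne j\le n}|(z_i,z_j|z)|^{\delta}\big)^{1/\delta}$ for $\gamma>1$, $\frac1\gamma+\frac1\delta=1$; $B_3=\Big[\big(\sum_{i=1}^n|\mu_i|\big)^2-\sum_{i=1}^n|\mu_i|^2\Big]\max_{1\le i\ne j\le n}|(z_i,z_j|z)|$. Then for every choice of $A\in\{A_1,A_2(\alpha),A_3\}$ and $B\in\{B_1,B_2(\gamma),B_3\}$ (with any admissible $\alpha,\gamma$), \[ \Big\|\sum_{i=1}^n\mu_iz_i\,\Big|\,z\Big\|^2\le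 A+B. \]
   Context: A 2-inner product on a linear space $X$ of dimension greater than $1$ over $\mathbb{K}$ ($\mathbb{K}=\mathbb{R}$ or $\mathbb{C}$) is a function $(\cdot,\cdot|\cdot):X\times X\times X\to\mathbb{K}$ such that for all $x,x',y,z\in X$ and $\alpha\in\mathbb{K}$: (i) $(x,x|z)\ge 0$, and $(x,x|z)=0$ iff $x$ and $z$ are linearly dependent; (ii) $(x,x|z)=(z,z|x)$; (iii) $(y,x|z)=\overline{(x,y|z)}$; (iv) $(\alpha x,y|z)=\alpha(x,y|z)$; (v) $(x+x',y|z)=(x,y|z)+(x',y|z)$. The associated 2-norm is $\|x|z\|=\sqrt{(x,x|z)}$. Sums and maxima indexed by $1\le i\ne j\le n$ run over all ordered pairs $(i,j)$ with $i,j\in\{1,\dots,n\}$, $i\ne j$. *)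

theory Defs
  imports "HOL-Analysis.Analysis"
begin

text \<open>Generic 2-inner products over a scalar field 'k (used with 'k = real, scaling (*R),
conjugation id; and 'k = complex, scaling (*C), conjugation cnj).\<close>

definition lin_dep2 :: "('k::field \<Rightarrow> 'a::ab_group_add \<Rightarrow> 'a) \<Rightarrow> 'a \<Rightarrow> 'a \<Rightarrow> bool" where
  "lin_dep2 sc x z \<longleftrightarrow> (\<exists>a b. (a \<noteq> 0 \<or> b \<noteq> 0) \<and> sc a x + sc b z = 0)"

definition two_inner_product ::
  "('k::real_normed_field \<Rightarrow> 'a::ab_group_add \<Rightarrow> 'a) \<Rightarrow> ('k \<Rightarrow> 'k) \<Rightarrow> ('a \<Rightarrow> 'a \<Rightarrow> 'a \<Rightarrow> 'k) \<Rightarrow> bool" where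
  "two_inner_product sc cj ip \<longleftrightarrow>
     (\<exists>x y. \<not> lin_dep2 sc x y) \<and>
     (\<forall>x z. ip x x z \<in> of_real ` {0..}) \<and>
     (\<forall>x z. ip x x z = 0 \<longleftrightarrow> lin_dep2 sc x z) \<and>
     (\<forall>x z. ip x x z = ip z z x) \<and>
     (\<forall>x y z. ip y x z = cj (ip x y z)) \<and>
     (\<forall>a x y z. ip (sc a x) y z = a * ip x y z) \<and>
     (\<forall>x x' y z. ip (x + x') y z = ip x y z + ip x' y z)"

text \<open>2-norm: \<open>\<parallel>x|z\<parallel> = sqrt (x,x|z)\<close>; (x,x|z) is a nonnegative real, equal to its norm.\<close>
definition twonorm :: "('a \<Rightarrow> 'a \<Rightarrow> 'a \<Rightarrow> 'k::real_normed_field) \<Rightarrow> 'a \<Rightarrow> 'a \<Rightarrow> real" where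
  "twonorm ip x z = sqrt (norm (ip x x z))"

definition offdiag :: "nat \<Rightarrow> (nat \<times> nat) set" where
  "offdiag n = {(i, j). i \<in> {1..n} \<and> j \<in> {1..n} \<and> i \<noteq> j}"

definition A1 :: "('a \<Rightarrow> 'a \<Rightarrow> 'a \<Rightarrow> 'k::real_normed_field) \<Rightarrow> nat \<Rightarrow> (nat \<Rightarrow> 'a) \<Rightarrow> 'a \<Rightarrow> (nat \<Rightarrow> 'k) \<Rightarrow> real" where
  "A1 ip n zs z \<mu> = (MAX i\<in>{1..n}. norm (\<mu> i) ^ 2) * (\<Sum>i=1..n. twonorm ip (zs i) z ^ 2)"

definition A2 :: "('a \<Rightarrow> 'a \<Rightarrow> 'a \<Rightarrow> 'k::real_normed_field) \<Rightarrow> nat \<Rightarrow> (nat \<Rightarrow> 'a) \<Rightarrow> 'a \<Rightarrow> (nat \<Rightarrow> 'k) \<Rightarrow> real \<Rightarrow> real \<Rightarrow> real" where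
  "A2 ip n zs z \<mu> \<alpha> \<beta> =
     (\<Sum>i=1..n. norm (\<mu> i) powr (2 * \<alpha>)) powr (1 / \<alpha>) *
     (\<Sum>i=1..n. twonorm ip (zs i) z powr (2 * \<beta>)) powr (1 / \<beta>)"

definition A3 :: "('a \<Rightarrow> 'a \<Rightarrow> 'a \<Rightarrow> 'k::real_normed_field) \<Rightarrow> nat \<Rightarrow> (nat \<Rightarrow> 'a) \<Rightarrow> 'a \<Rightarrow> (nat \<Rightarrow> 'k) \<Rightarrow> real" where
  "A3 ip n zs z \<mu> = (\<Sum>i=1..n. norm (\<mu> i) ^ 2) * (MAX i\<in>{1..n}. twonorm ip (zs i) z ^ 2)"

definition B1 :: "('a \<Rightarrow> 'a \<Rightarrow> 'a \<Rightarrow> 'k::real_normed_field) \<Rightarrow> nat \<Rightarrow> (nat \<Rightarrow> 'a) \<Rightarrow> 'a \<Rightarrow> (nat \<Rightarrow> 'k) \<Rightarrow> real" where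
  "B1 ip n zs z \<mu> = (MAX (i, j)\<in>offdiag n. norm (\<mu> i * \<mu> j)) *
                    (\<Sum>(i, j)\<in>offdiag n. norm (ip (zs i) (zs j) z))"

definition B2 :: "('a \<Rightarrow> 'a \<Rightarrow> 'a \<Rightarrow> 'k::real_normed_field) \<Rightarrow> nat \<Rightarrow> (nat \<Rightarrow> 'a) \<Rightarrow> 'a \<Rightarrow> (nat \<Rightarrow> 'k) \<Rightarrow> real \<Rightarrow> real \<Rightarrow> real" where
  "B2 ip n zs z \<mu> \<gamma> \<delta> =
     ((\<Sum>i=1..n. norm (\<mu> i) powr \<gamma>) ^ 2 - (\<Sum>i=1..n. norm (\<mu> i) powr (2 * \<gamma>))) powr (1 / \<gamma>) *
     (\<Sum>(i, j)\<in>offdiag n. norm (ip (zs i) (zs j) z) powr \<delta>) powr (1 / \<delta>)"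

definition B3 :: "('a \<Rightarrow> 'a \<Rightarrow> 'a \<Rightarrow> 'k::real_normed_field) \<Rightarrow> nat \<Rightarrow> (nat \<Rightarrow> 'a) \<Rightarrow> 'a \<Rightarrow> (nat \<Rightarrow> 'k) \<Rightarrow> real" where
  "B3 ip n zs z \<mu> = ((\<Sum>i=1..n. norm (\<mu> i)) ^ 2 - (\<Sum>i=1..n. norm (\<mu> i) ^ 2)) *
                    (MAX (i, j)\<in>offdiag n. norm (ip (zs i) (zs j) z))"

end

theory Submission
  imports Defs
begin

text \<open>Expanding \<open>(s, s | z)\<close> for \<open>s = \<Sum>\<mu>\<^sub>i z\<^sub>i\<close> by sesquilinearity and the triangle inequality gives
  \<open>\<parallel>s|z\<parallel>\<^sup>2 \<le> D + O\<close>, where \<open>D = \<Sum>|\<mu>\<^sub>i|\<^sup>2 \<parallel>z\<^sub>i|z\<parallel>\<^sup>2\<close> collects the diagonal and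
  \<open>O = \<Sum>\<^sub>i\<^sub>\<noteq>\<^sub>j |\<mu>\<^sub>i| |\<mu>\<^sub>j| |(z\<^sub>i, z\<^sub>j | z)|\<close> the off-diagonal terms. Each of \<open>D\<close> and \<open>O\<close> is a sum of
  products of nonnegative reals, and the three bounds on each are the Hoelder inequality
  with exponents \<open>(\<infinity>, 1)\<close>, \<open>(p, q)\<close> and \<open>(1, \<infinity>)\<close>; for \<open>O\<close> one uses in addition
  \<open>\<Sum>\<^sub>i\<^sub>\<noteq>\<^sub>j c\<^sub>i c\<^sub>j = (\<Sum>c\<^sub>i)\<^sup>2 - \<Sum>c\<^sub>i\<^sup>2\<close>.\<close>

lemma conjugate_exponent_gt_1:
  fixes p q :: real
  assumes "p > 1" and "1 / p + 1 / q = 1"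
  shows "q > 1"
  using assms by (smt (verit, ccfv_SIG) divide_less_eq_1_pos zero_less_divide_1_iff)

lemma power2_powr: "(x :: real) \<ge> 0 \<Longrightarrow> (x ^ 2) powr r = x powr (2 * r)"
  by (simp add: powr_powr flip: powr_numeral)

lemma powr_power2: "((x :: real) powr r) ^ 2 = x powr (2 * r)"
  by (simp add: powr_powr mult.commute flip: powr_numeral)

lemma sum_mult_le_Max_mult_sum:
  fixes x y :: "'i \<Rightarrow> real"
  assumes "finite I" and "\<And>i. i \<in> I \<Longrightarrow> y i \<ge> 0"
  shows "(\<Sum>i\<in>I. x i * y i) \<le> (MAX i\<in>I. x i) * (\<Sum>i\<in>I. y i)"
proof (cases "I = {}")
  case False
  have "(\<Sum>i\<in>I. x i * y i) \<le> (\<Sum>i\<in>I. (MAX i\<in>I. x i) * y i)"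
    using assms by (intro sum_mono mult_right_mono) auto
  then show ?thesis
    by (simp add: sum_distrib_left)
qed simp

lemma Holder_inequality_sum:
  fixes x y :: "'i \<Rightarrow> real"
  assumes fin: "finite I" and x0: "\<And>i. i \<in> I \<Longrightarrow> x i \<ge> 0" and y0: "\<And>i. i \<in> I \<Longrightarrow> y i \<ge> 0"
    and p: "p > 1" and pq: "1 / p + 1 / q = 1"
  shows "(\<Sum>i\<in>I. x i * y i) \<le> (\<Sum>i\<in>I. x i powr p) powr (1 / p) * (\<Sum>i\<in>I. y i powr q) powr (1 / q)"
proof -
  have q: "q > 1"
    using p pq by (rule conjugate_exponent_gt_1)
  define P where "P = (\<Sum>i\<in>I. x i powr p)"
  define Q where "Q = (\<Sum>i\<in>I. y i powr q)"
  have "P \<ge> 0" "Q \<ge> 0"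
    unfolding P_def Q_def by (auto intro: sum_nonneg)
  show ?thesis
  proof (cases "P = 0 \<or> Q = 0")
    case True
    then have "(\<forall>i\<in>I. x i = 0) \<or> (\<forall>i\<in>I. y i = 0)"
      using fin x0 y0 by (auto simp: P_def Q_def sum_nonneg_eq_0_iff)
    then show ?thesis
      by auto
  next
    case False
    with \<open>P \<ge> 0\<close> \<open>Q \<ge> 0\<close> have "P > 0" "Q > 0"
      by auto
    define c where "c = P powr (1 / p)"
    define d where "d = Q powr (1 / q)"
    have "c > 0" "d > 0"
      using \<open>P > 0\<close> \<open>Q > 0\<close> by (auto simp: c_def d_def)
    have cp: "c powr p = P" and dq: "d powr q = Q"
      using p q \<open>P \<ge> 0\<close> \<open>Q \<ge> 0\<close> by (simp_all add: c_def d_def powr_powr)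
    have "(\<Sum>i\<in>I. (x i / c) * (y i / d)) \<le> (\<Sum>i\<in>I. (x i / c) powr p / p + (y i / d) powr q / q)"
      using p q pq x0 y0 \<open>c > 0\<close> \<open>d > 0\<close> by (intro sum_mono Youngs_inequality) auto
    also have "\<dots> = P / (p * P) + Q / (q * Q)"
      by (simp add: P_def Q_def powr_divide cp dq sum.distrib sum_divide_distrib mult.commute)
    also have "\<dots> = 1"
      using \<open>P > 0\<close> \<open>Q > 0\<close> pq by simp
    finally have "(\<Sum>i\<in>I. x i * y i) / (c * d) \<le> 1"
      by (simp add: sum_divide_distrib)
    then show ?thesis
      using \<open>c > 0\<close> \<open>d > 0\<close> by (simp add: divide_le_eq c_def d_def P_def Q_def)
  qed
qed

lemma finite_offdiag: "finite (offdiag n)"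
  by (rule finite_subset[of _ "{1..n} \<times> {1..n}"]) (auto simp: offdiag_def)

lemma sum_sum_diag_offdiag:
  "(\<Sum>i=1..n. \<Sum>j=1..n. f i j) = (\<Sum>i=1..n. f i i) + (\<Sum>(i, j)\<in>offdiag n. f i j)"
proof -
  have square: "{1..n} \<times> {1..n} = (\<lambda>i. (i, i)) ` {1..n} \<union> offdiag n"
    by (auto simp: offdiag_def)
  have "(\<Sum>i=1..n. \<Sum>j=1..n. f i j) = (\<Sum>(i, j)\<in>(\<lambda>i. (i, i)) ` {1..n} \<union> offdiag n. f i j)"
    by (simp only: sum.cartesian_product square)
  also have "\<dots> = (\<Sum>(i, j)\<in>(\<lambda>i. (i, i)) ` {1..n}. f i j) + (\<Sum>(i, j)\<in>offdiag n. f i j)"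
    using finite_offdiag by (intro sum.union_disjoint) (auto simp: offdiag_def)
  also have "(\<Sum>(i, j)\<in>(\<lambda>i. (i, i)) ` {1..n}. f i j) = (\<Sum>i=1..n. f i i)"
    by (subst sum.reindex) (auto simp: inj_on_def)
  finally show ?thesis .
qed

lemma sum_offdiag_mult:
  fixes c :: "nat \<Rightarrow> real"
  shows "(\<Sum>(i, j)\<in>offdiag n. c i * c j) = (\<Sum>i=1..n. c i) ^ 2 - (\<Sum>i=1..n. c i ^ 2)"
  using sum_sum_diag_offdiag[of "\<lambda>i j. c i * c j" n]
  by (simp add: power2_eq_square sum_product)

definition diag_sum ::
    "('a \<Rightarrow> 'a \<Rightarrow> 'a \<Rightarrow> 'k::real_normed_field) \<Rightarrow> nat \<Rightarrow> (nat \<Rightarrow> 'a) \<Rightarrow> 'a \<Rightarrow> (nat \<Rightarrow> 'k) \<Rightarrow> real" where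
  "diag_sum ip n zs z \<mu> = (\<Sum>i=1..n. norm (\<mu> i) ^ 2 * twonorm ip (zs i) z ^ 2)"

definition offdiag_sum ::
    "('a \<Rightarrow> 'a \<Rightarrow> 'a \<Rightarrow> 'k::real_normed_field) \<Rightarrow> nat \<Rightarrow> (nat \<Rightarrow> 'a) \<Rightarrow> 'a \<Rightarrow> (nat \<Rightarrow> 'k) \<Rightarrow> real" where
  "offdiag_sum ip n zs z \<mu> =
     (\<Sum>(i, j)\<in>offdiag n. norm (\<mu> i) * norm (\<mu> j) * norm (ip (zs i) (zs j) z))"

lemma twonorm_nonneg: "twonorm ip x z \<ge> 0"
  by (simp add: twonorm_def)

lemma twonorm_power2: "twonorm ip x z ^ 2 = norm (ip x x z)"
  by (simp add: twonorm_def)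

lemma diag_sum_le_A1: "diag_sum ip n zs z \<mu> \<le> A1 ip n zs z \<mu>"
  unfolding diag_sum_def A1_def by (rule sum_mult_le_Max_mult_sum) auto

lemma diag_sum_le_A2:
  assumes "\<alpha> > 1" and "1 / \<alpha> + 1 / \<beta> = 1"
  shows "diag_sum ip n zs z \<mu> \<le> A2 ip n zs z \<mu> \<alpha> \<beta>"
proof -
  have "diag_sum ip n zs z \<mu>
      \<le> (\<Sum>i=1..n. (norm (\<mu> i) ^ 2) powr \<alpha>) powr (1 / \<alpha>) *
        (\<Sum>i=1..n. (twonorm ip (zs i) z ^ 2) powr \<beta>) powr (1 / \<beta>)"
    unfolding diag_sum_def using assms by (intro Holder_inequality_sum) auto
  then show ?thesis
    by (simp add: A2_def power2_powr twonorm_nonneg)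
qed

lemma diag_sum_le_A3: "diag_sum ip n zs z \<mu> \<le> A3 ip n zs z \<mu>"
  using sum_mult_le_Max_mult_sum[where I = "{1..n}" and x = "\<lambda>i. twonorm ip (zs i) z ^ 2"
      and y = "\<lambda>i. norm (\<mu> i) ^ 2"]
  by (simp add: diag_sum_def A3_def mult.commute)

lemma offdiag_sum_le_B1: "offdiag_sum ip n zs z \<mu> \<le> B1 ip n zs z \<mu>"
  using sum_mult_le_Max_mult_sum[OF finite_offdiag[of n],
      where x = "\<lambda>(i, j). norm (\<mu> i * \<mu> j)" and y = "\<lambda>(i, j). norm (ip (zs i) (zs j) z)"]
  by (simp add: offdiag_sum_def B1_def case_prod_unfold norm_mult)

lemma offdiag_sum_le_B2:
  assumes "\<gamma> > 1" and "1 / \<gamma> + 1 / \<delta> = 1"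
  shows "offdiag_sum ip n zs z \<mu> \<le> B2 ip n zs z \<mu> \<gamma> \<delta>"
proof -
  have "offdiag_sum ip n zs z \<mu>
      \<le> (\<Sum>(i, j)\<in>offdiag n. (norm (\<mu> i) * norm (\<mu> j)) powr \<gamma>) powr (1 / \<gamma>) *
        (\<Sum>(i, j)\<in>offdiag n. norm (ip (zs i) (zs j) z) powr \<delta>) powr (1 / \<delta>)"
    using Holder_inequality_sum[OF finite_offdiag[of n] _ _ assms,
        where x = "\<lambda>(i, j). norm (\<mu> i) * norm (\<mu> j)" and y = "\<lambda>(i, j). norm (ip (zs i) (zs j) z)"]
    by (simp add: offdiag_sum_def case_prod_unfold)
  also have "(\<Sum>(i, j)\<in>offdiag n. (norm (\<mu> i) * norm (\<mu> j)) powr \<gamma>)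
      = (\<Sum>i=1..n. norm (\<mu> i) powr \<gamma>) ^ 2 - (\<Sum>i=1..n. norm (\<mu> i) powr (2 * \<gamma>))"
    using sum_offdiag_mult[of "\<lambda>i. norm (\<mu> i) powr \<gamma>" n]
    by (simp add: powr_mult powr_power2)
  finally show ?thesis
    by (simp add: B2_def)
qed

lemma offdiag_sum_le_B3: "offdiag_sum ip n zs z \<mu> \<le> B3 ip n zs z \<mu>"
proof -
  have "offdiag_sum ip n zs z \<mu> \<le> (MAX (i, j)\<in>offdiag n. norm (ip (zs i) (zs j) z)) *
      (\<Sum>(i, j)\<in>offdiag n. norm (\<mu> i) * norm (\<mu> j))"
    using sum_mult_le_Max_mult_sum[OF finite_offdiag[of n],
        where x = "\<lambda>(i, j). norm (ip (zs i) (zs j) z)" and y = "\<lambda>(i, j). norm (\<mu> i) * norm (\<mu> j)"]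
    by (simp add: offdiag_sum_def case_prod_unfold mult_ac)
  then show ?thesis
    using sum_offdiag_mult[of "\<lambda>i. norm (\<mu> i)" n] by (simp add: B3_def mult.commute)
qed

text \<open>The estimate uses only these consequences of the 2-inner-product axioms.\<close>

locale hermitian_2form =
  fixes sc :: "'k::real_normed_field \<Rightarrow> 'a::ab_group_add \<Rightarrow> 'a"
    and cj :: "'k \<Rightarrow> 'k"
    and ip :: "'a \<Rightarrow> 'a \<Rightarrow> 'a \<Rightarrow> 'k"
  assumes ip_add_left: "ip (x + x') y z = ip x y z + ip x' y z"
    and ip_scale_left: "ip (sc a x) y z = a * ip x y z"
    and ip_conj_sym: "ip y x z = cj (ip x y z)"
    and norm_cj: "norm (cj w) = norm w"
begin

lemma ip_zero_left: "ip 0 y z = 0"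
  using ip_add_left[of 0 0 y z] by simp

lemma ip_sum_left: "ip (\<Sum>i\<in>I. sc (\<mu> i) (zs i)) y z = (\<Sum>i\<in>I. \<mu> i * ip (zs i) y z)"
  by (induction I rule: infinite_finite_induct) (simp_all add: ip_zero_left ip_add_left ip_scale_left)

lemma norm_ip_commute: "norm (ip y x z) = norm (ip x y z)"
  by (metis ip_conj_sym norm_cj)

lemma norm_ip_sum_left_le:
  "norm (ip (\<Sum>i\<in>I. sc (\<mu> i) (zs i)) y z) \<le> (\<Sum>i\<in>I. norm (\<mu> i) * norm (ip (zs i) y z))"
  unfolding ip_sum_left by (rule order_trans[OF norm_sum]) (simp add: norm_mult)

lemma norm_ip_sum_sum_le:
  "norm (ip (\<Sum>i\<in>I. sc (\<mu> i) (zs i)) (\<Sum>i\<in>I. sc (\<mu> i) (zs i)) z)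
     \<le> (\<Sum>i\<in>I. \<Sum>j\<in>I. norm (\<mu> i) * norm (\<mu> j) * norm (ip (zs i) (zs j) z))"
proof -
  let ?s = "\<Sum>i\<in>I. sc (\<mu> i) (zs i)"
  have "norm (ip ?s ?s z) \<le> (\<Sum>i\<in>I. norm (\<mu> i) * norm (ip ?s (zs i) z))"
    using norm_ip_sum_left_le[where I = I and \<mu> = \<mu> and zs = zs and y = ?s and z = z]
    by (simp add: norm_ip_commute)
  also have "\<dots> \<le> (\<Sum>i\<in>I. norm (\<mu> i) * (\<Sum>j\<in>I. norm (\<mu> j) * norm (ip (zs i) (zs j) z)))"
    using norm_ip_sum_left_le[where I = I and \<mu> = \<mu> and zs = zs]
    by (intro sum_mono mult_left_mono) (simp_all add: norm_ip_commute)
  finally show ?thesis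
    by (simp add: sum_distrib_left mult.assoc)
qed

lemma twonorm_sum_power2_le:
  "twonorm ip (\<Sum>i=1..n. sc (\<mu> i) (zs i)) z ^ 2 \<le> diag_sum ip n zs z \<mu> + offdiag_sum ip n zs z \<mu>"
  using norm_ip_sum_sum_le[where I = "{1..n}" and \<mu> = \<mu> and zs = zs and z = z]
  unfolding twonorm_power2 diag_sum_def offdiag_sum_def sum_sum_diag_offdiag
  by (simp add: power2_eq_square)

theorem twonorm_sum_power2_le_A_plus_B:
  assumes "\<alpha> > 1" and "1 / \<alpha> + 1 / \<beta> = 1"
    and "\<gamma> > 1" and "1 / \<gamma> + 1 / \<delta> = 1"
  shows "\<forall>A \<in> {A1 ip n zs z \<mu>, A2 ip n zs z \<mu> \<alpha> \<beta>, A3 ip n zs z \<mu>}.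
           \<forall>B \<in> {B1 ip n zs z \<mu>, B2 ip n zs z \<mu> \<gamma> \<delta>, B3 ip n zs z \<mu>}.
             twonorm ip (\<Sum>i=1..n. sc (\<mu> i) (zs i)) z ^ 2 \<le> A + B"
proof (intro ballI)
  fix A B
  assume "A \<in> {A1 ip n zs z \<mu>, A2 ip n zs z \<mu> \<alpha> \<beta>, A3 ip n zs z \<mu>}"
  then have "diag_sum ip n zs z \<mu> \<le> A"
    using diag_sum_le_A1[of ip n zs z \<mu>] diag_sum_le_A2[OF assms(1,2), of ip n zs z \<mu>]
      diag_sum_le_A3[of ip n zs z \<mu>]
    by auto
  moreover assume "B \<in> {B1 ip n zs z \<mu>, B2 ip n zs z \<mu> \<gamma> \<delta>, B3 ip n zs z \<mu>}"
  then have "offdiag_sum ip n zs z \<mu> \<le> B"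
    using offdiag_sum_le_B1[of ip n zs z \<mu>] offdiag_sum_le_B2[OF assms(3,4), of ip n zs z \<mu>]
      offdiag_sum_le_B3[of ip n zs z \<mu>]
    by auto
  ultimately show "twonorm ip (\<Sum>i=1..n. sc (\<mu> i) (zs i)) z ^ 2 \<le> A + B"
    using twonorm_sum_power2_le[where n = n and \<mu> = \<mu> and zs = zs and z = z]
    by linarith
qed

end

lemma two_inner_product_hermitian_2form:
  assumes "two_inner_product sc cj ip" and "\<And>w. norm (cj w) = norm w"
  shows "hermitian_2form sc cj ip"
proof
  show "ip (x + x') y z = ip x y z + ip x' y z" for x x' y z
    using assms(1) unfolding two_inner_product_def by blast
  show "ip (sc a x) y z = a * ip x y z" for a x y z
    using assms(1) unfolding two_inner_product_def by blast
  show "ip y x z = cj (ip x y z)" for x y z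
    using assms(1) unfolding two_inner_product_def by blast
qed (fact assms(2))

theorem lemma2p1:
  fixes n :: nat and \<alpha> \<beta> \<gamma> \<delta> :: real
  assumes "n \<ge> 1"
    and "\<alpha> > 1" and "1 / \<alpha> + 1 / \<beta> = 1"
    and "\<gamma> > 1" and "1 / \<gamma> + 1 / \<delta> = 1"
  shows
   "(\<forall>(ip :: 'a::real_vector \<Rightarrow> 'a \<Rightarrow> 'a \<Rightarrow> real) (zs :: nat \<Rightarrow> 'a) (z :: 'a) (\<mu> :: nat \<Rightarrow> real).
       two_inner_product (*\<^sub>R) id ip \<longrightarrow>
       (\<forall>A \<in> {A1 ip n zs z \<mu>, A2 ip n zs z \<mu> \<alpha> \<beta>, A3 ip n zs z \<mu>}.
        \<forall>B \<in> {B1 ip n zs z \<mu>, B2 ip n zs z \<mu> \<gamma> \<delta>, B3 ip n zs z \<mu>}.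
          twonorm ip (\<Sum>i=1..n. \<mu> i *\<^sub>R zs i) z ^ 2 \<le> A + B))
    \<and>
    (\<forall>(sc :: complex \<Rightarrow> 'b::ab_group_add \<Rightarrow> 'b) (ip :: 'b \<Rightarrow> 'b \<Rightarrow> 'b \<Rightarrow> complex) (zs :: nat \<Rightarrow> 'b) (z :: 'b) (\<mu> :: nat \<Rightarrow> complex).
       vector_space sc \<and> two_inner_product sc cnj ip \<longrightarrow>
       (\<forall>A \<in> {A1 ip n zs z \<mu>, A2 ip n zs z \<mu> \<alpha> \<beta>, A3 ip n zs z \<mu>}.
        \<forall>B \<in> {B1 ip n zs z \<mu>, B2 ip n zs z \<mu> \<gamma> \<delta>, B3 ip n zs z \<mu>}.
          twonorm ip (\<Sum>i=1..n. sc (\<mu> i) (zs i)) z ^ 2 \<le> A + B))"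
  by (intro conjI allI impI hermitian_2form.twonorm_sum_power2_le_A_plus_B
      [OF two_inner_product_hermitian_2form assms(2-5)]) (blast | simp)+

end
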